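(* Consider the two-site model $\dot x=f(x)+g_1(x)u_1+g_2(x)u_2$ with outputs $y_1=h_{\rm e}(x)$, $y_2=h_{\rm h}(x)$ defined in the context, with $D$ as in the context, and references $Y_1^{\rm ref},Y_2^{\rm ref}\in\mathbb{R}$. Let $\dot\eta=F(\eta)$ on $Z$ be the zero dynamics with respect to the set-point error $(y_1-Y_1^{\rm ref},y_2-Y_2^{\rm ref})$. If $\eta^\ast=(\eta_1^\ast,\eta_2^\ast,\eta_3^\ast,\eta_4^\ast)^\top\in Z$ is an equilibrium point of the zero dynamics, then every point of the set $$\mathcal{I}^\ast=\{(\eta_1^\ast,\eta_2^\ast,\eta_3^\ast,\eta_4^\ast+a)^\top \mid a\in\mathbb{R}\}$$ is also an equilibrium point of the zero dynamics. Hence no equilibrium point of the zero dynamics is isolated, no equilibrium point of the zero dynamics is asymptotically stable, and the model is a non-minimum phase system (its zero dynamics have no asymptotically stable equilibrium point), whether or not an equilibrium point with zero set-point error exists.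
   Context: **Model.** State $x=(x_{\rm g},x_{\rm e},x_{\rm h})\in X\subset\mathbb{R}^6\times\mathbb{R}^4\times\mathbb{R}^3$, where $X=\{x\in\mathbb{R}^{13}: x_{\rm h2}>0\}$; inputs $u_1,u_2\in\mathbb{R}$; $\dot x=f(x)+g_1u_1+g_2u_2$ with $f=(f_{\rm g},f_{\rm e},f_{\rm h})$ and $g_i=(g_{{\rm g}i},0,0)$. Parameters, for $i=1,2$: $T_{{\rm v}i},T_{{\rm f}i},T_{{\rm CD}i},T_{{\rm e}i},T_{\rm h1},T_{\rm h2},T_{\rm h3},K_{{\rm e}i},K_{{\rm h}i},D_i,\rho_{\rm s},\lambda,L,d,h_{\rm c}>0$; $0\le W_{{\rm o}i}<1$; $\beta_i\ge 0$; $Q'_{{\rm L}i}\in\mathbb{R}$; $E_1,E_2,E_\infty>0$; real $G_{ij},B_{ij}$ symmetric in $i,j\in\{1,2,\infty\}$ with $B_{1\infty},B_{2\infty}>0$. Functions: $P_{{\rm m}i}(w)=K_{{\rm e}i}(w-W_{{\rm o}i})/(1-W_{{\rm o}i})$; $Q'_{{\rm a}i}(w)=K_{{\rm h}i}(w+\beta_i)/(1+\beta_i)$; $Q'_{12}(w)=-Q'_{21}(w)=\frac{\pi}{4}h_{\rm c}\rho_{\rm s}w$; $P_{{\rm e}i}(\delta_1,\delta_2)=\sum_{j\in\{1,2,\infty\}}E_iE_j\{G_{ij}\cos(\delta_i-\delta_j)+B_{ij}\sin(\delta_i-\delta_j)\}$ with $\delta_\infty=0$; $P_{{\rm e}\infty}(\delta_1,\delta_2)=\sum_{i=1}^2E_\infty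 E_i\{B_{\infty i}\sin\delta_i-G_{\infty i}\cos\delta_i\}$. Vector fields: $f_{\rm g}=\big(\tfrac{-x_{\rm g1}+W_{\rm o1}}{T_{\rm v1}},\tfrac{-x_{\rm g2}+x_{\rm g1}}{T_{\rm f1}},\tfrac{-x_{\rm g3}+x_{\rm g2}}{T_{\rm CD1}},\tfrac{-x_{\rm g4}+W_{\rm o2}}{T_{\rm v2}},\tfrac{-x_{\rm g5}+x_{\rm g4}}{T_{\rm f2}},\tfrac{-x_{\rm g6}+x_{\rm g5}}{T_{\rm CD2}}\big)^\top$; $g_{\rm g1}=(\tfrac{1-W_{\rm o1}}{T_{\rm v1}},0,0,0,0,0)^\top$, $g_{\rm g2}=(0,0,0,\tfrac{1-W_{\rm o2}}{T_{\rm v2}},0,0)^\top$; $f_{\rm e}=\big(\tfrac{x_{\rm e2}}{T_{\rm e1}},\tfrac{P_{\rm m1}(x_{\rm g3})-D_1x_{\rm e2}-P_{\rm e1}(x_{\rm e1},x_{\rm e3})}{T_{\rm e1}},\tfrac{x_{\rm e4}}{T_{\rm e2}},\tfrac{P_{\rm m2}(x_{\rm g6})-D_2x_{\rm e4}-P_{\rm e2}(x_{\rm e1},x_{\rm e3})}{T_{\rm e2}}\big)^\top$; $f_{\rm h1}=\tfrac{Q'_{\rm a1}(x_{\rm g2})-Q'_{\rm L1}-Q'_{12}(x_{\rm h2})}{T_{\rm h1}}-\tfrac{Q'_{\rm a2}(x_{\rm g5})-Q'_{\rm L2}-Q'_{21}(x_{\rm h2})}{T_{\rm h2}}$, $f_{\rm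 h2}=\tfrac1{T_{\rm h3}}\big(\tfrac{x_{\rm h1}}{\rho_{\rm s}}-\tfrac{\lambda L}{2d}x_{\rm h2}|x_{\rm h2}|\big)$, $f_{\rm h3}=\tfrac{Q'_{\rm a1}(x_{\rm g2})-Q'_{\rm L1}+Q'_{\rm a2}(x_{\rm g5})-Q'_{\rm L2}}{T_{\rm h1}+T_{\rm h2}}$. Outputs: $h_{\rm e}(x)=P_{{\rm e}\infty}(x_{\rm e1},x_{\rm e3})$, $h_{\rm h}(x)=Q'_{12}(x_{\rm h2})$. **Normal-form coordinates.** $L_f$ denotes the Lie derivative along $f$. $\Phi(x)=(\xi_{\rm e},\xi_{\rm h},\eta)\in\mathbb{R}^5\times\mathbb{R}^4\times\mathbb{R}^4$ with $\xi_{\rm e}=[h_{\rm e},L_fh_{\rm e},\dots,L_f^4h_{\rm e}]^\top(x)$, $\xi_{\rm h}=[h_{\rm h},L_fh_{\rm h},L_f^2h_{\rm h},L_f^3h_{\rm h}]^\top(x)$, $\eta=[x_{\rm g3},x_{\rm e1},x_{\rm e2},x_{\rm h3}]^\top$. $D\subset X$ is an open set, invariant under translations in the coordinate $x_{\rm h3}$, on which the model has vector relative degree $\{5,4\}$ with respect to $(y_1,y_2)$ and such that $\Phi$ restricted to $D$ is a diffeomorphism onto its image. **Zero dynamics.** $r(x)=[f_{\rm g3},f_{\rm e1},f_{\rm e2},f_{\rm h3}]^\top(x)$, $q:=r\circ\Phi^{-1}$ on $\Phi(D)$, $Z=\{\eta\in\mathbb{R}^4:([Y_1^{\rm ref},0,0,0,0]^\top,[Y_2^{\rm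 ref},0,0,0]^\top,\eta)\in\Phi(D)\}$ and $F(\eta)=q([Y_1^{\rm ref},0,0,0,0]^\top,[Y_2^{\rm ref},0,0,0]^\top,\eta)$ for $\eta\in Z$. The zero dynamics are $\dot\eta=F(\eta)$ on $Z$. The system is called minimum phase if its zero dynamics have an asymptotically stable equilibrium point, and non-minimum phase otherwise. *)

theory Defs
  imports "HOL-Analysis.Analysis"
begin

definition lie_deriv :: "('a::real_normed_vector \<Rightarrow> 'a) \<Rightarrow> ('a \<Rightarrow> real) \<Rightarrow> 'a \<Rightarrow> real" where
  "lie_deriv v h = (\<lambda>x. frechet_derivative h (at x) (v x))"

definition lie_deriv_pow :: "('a::real_normed_vector \<Rightarrow> 'a) \<Rightarrow> nat \<Rightarrow> ('a \<Rightarrow> real) \<Rightarrow> 'a \<Rightarrow> real" where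
  "lie_deriv_pow v k = (lie_deriv v ^^ k)"

text \<open>The last condition is nonsingularity of the decoupling matrix.\<close>

definition vector_relative_degree_on ::
  "'a::real_normed_vector set \<Rightarrow> ('a \<Rightarrow> 'a) \<Rightarrow> ('m::finite \<Rightarrow> 'a \<Rightarrow> 'a) \<Rightarrow> ('m \<Rightarrow> 'a \<Rightarrow> real) \<Rightarrow> ('m \<Rightarrow> nat) \<Rightarrow> bool"
  where
  "vector_relative_degree_on S f g h \<rho> \<longleftrightarrow>
     (\<forall>i. 1 \<le> \<rho> i) \<and>
     (\<forall>x\<in>S. \<forall>i j k. k < \<rho> i - 1 \<longrightarrow> lie_deriv (g j) (lie_deriv_pow f k (h i)) x = 0) \<and>
     (\<forall>x\<in>S. invertible (\<chi> i j. lie_deriv (g j) (lie_deriv_pow f (\<rho> i - 1) (h i)) x))"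

text \<open>Intended for open \<open>S\<close>: being \<open>C\<^sup>k\<close> is expressed through all iterated directional derivatives.\<close>

primrec Ck_on :: "nat \<Rightarrow> 'a::real_normed_vector set \<Rightarrow> ('a \<Rightarrow> 'b::real_normed_vector) \<Rightarrow> bool" where
  "Ck_on 0 S f \<longleftrightarrow> continuous_on S f"
| "Ck_on (Suc k) S f \<longleftrightarrow>
     (\<forall>x\<in>S. f differentiable (at x)) \<and> (\<forall>v. Ck_on k S (\<lambda>x. frechet_derivative f (at x) v))"

definition smooth_on :: "'a::real_normed_vector set \<Rightarrow> ('a \<Rightarrow> 'b::real_normed_vector) \<Rightarrow> bool" where
  "smooth_on S f \<longleftrightarrow> (\<forall>k. Ck_on k S f)"

definition diffeomorphism_on_image ::
  "'a::real_normed_vector set \<Rightarrow> ('a \<Rightarrow> 'b::real_normed_vector) \<Rightarrow> bool" where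
  "diffeomorphism_on_image S \<phi> \<longleftrightarrow>
     open S \<and> open (\<phi> ` S) \<and> inj_on \<phi> S \<and> smooth_on S \<phi> \<and> smooth_on (\<phi> ` S) (the_inv_into S \<phi>)"

definition equilibria :: "('a::real_normed_vector \<Rightarrow> 'a) \<Rightarrow> 'a set \<Rightarrow> 'a set" where
  "equilibria F Z = {\<eta> \<in> Z. F \<eta> = 0}"

definition solution_on :: "('a::real_normed_vector \<Rightarrow> 'a) \<Rightarrow> 'a set \<Rightarrow> real set \<Rightarrow> (real \<Rightarrow> 'a) \<Rightarrow> bool" where
  "solution_on F Z J \<eta> \<longleftrightarrow>
     (\<forall>t\<in>J. \<eta> t \<in> Z \<and> (\<eta> has_vector_derivative F (\<eta> t)) (at t within J))"

definition lyapunov_stable :: "('a::real_normed_vector \<Rightarrow> 'a) \<Rightarrow> 'a set \<Rightarrow> 'a \<Rightarrow> bool" where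
  "lyapunov_stable F Z e \<longleftrightarrow>
     (\<forall>\<epsilon>>0. \<exists>\<delta>>0. \<forall>\<eta> T. 0 < T \<longrightarrow> solution_on F Z {0..<T} \<eta> \<longrightarrow> dist (\<eta> 0) e < \<delta> \<longrightarrow>
        (\<forall>t\<in>{0..<T}. dist (\<eta> t) e < \<epsilon>))"

definition locally_attractive :: "('a::real_normed_vector \<Rightarrow> 'a) \<Rightarrow> 'a set \<Rightarrow> 'a \<Rightarrow> bool" where
  "locally_attractive F Z e \<longleftrightarrow>
     (\<exists>\<delta>>0. \<forall>\<eta>. solution_on F Z {0..} \<eta> \<longrightarrow> dist (\<eta> 0) e < \<delta> \<longrightarrow> (\<eta> \<longlongrightarrow> e) at_top)"

definition asymptotically_stable :: "('a::real_normed_vector \<Rightarrow> 'a) \<Rightarrow> 'a set \<Rightarrow> 'a \<Rightarrow> bool" where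
  "asymptotically_stable F Z e \<longleftrightarrow>
     e \<in> equilibria F Z \<and> lyapunov_stable F Z e \<and> locally_attractive F Z e"

text \<open>Sites are indexed by the two-element type, whose elements are \<open>1\<close> and \<open>2\<close>.\<close>

datatype bus = Site 2 | Infinite_Bus

record params =
  Tv :: "2 \<Rightarrow> real"
  Tf :: "2 \<Rightarrow> real"
  TCD :: "2 \<Rightarrow> real"
  Te :: "2 \<Rightarrow> real"
  Th1 :: real
  Th2 :: real
  Th3 :: real
  Ke :: "2 \<Rightarrow> real"
  Kh :: "2 \<Rightarrow> real"
  Damp :: "2 \<Rightarrow> real"
  rho_s :: real
  pipe_lambda :: real
  pipe_L :: real
  pipe_d :: real
  h_c :: real
  Wo :: "2 \<Rightarrow> real"
  beta :: "2 \<Rightarrow> real"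
  QL :: "2 \<Rightarrow> real"
  volt :: "bus \<Rightarrow> real"
  Gc :: "bus \<Rightarrow> bus \<Rightarrow> real"
  Bs :: "bus \<Rightarrow> bus \<Rightarrow> real"

definition valid_params :: "params \<Rightarrow> bool" where
  "valid_params p \<longleftrightarrow>
     (\<forall>i. 0 < Tv p i \<and> 0 < Tf p i \<and> 0 < TCD p i \<and> 0 < Te p i \<and> 0 < Ke p i \<and> 0 < Kh p i \<and> 0 < Damp p i) \<and>
     0 < Th1 p \<and> 0 < Th2 p \<and> 0 < Th3 p \<and>
     0 < rho_s p \<and> 0 < pipe_lambda p \<and> 0 < pipe_L p \<and> 0 < pipe_d p \<and> 0 < h_c p \<and>
     (\<forall>i. 0 \<le> Wo p i \<and> Wo p i < 1) \<and>
     (\<forall>i. 0 \<le> beta p i) \<and>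
     (\<forall>j. 0 < volt p j) \<and>
     (\<forall>i j. Gc p i j = Gc p j i \<and> Bs p i j = Bs p j i) \<and>
     (\<forall>i. 0 < Bs p (Site i) Infinite_Bus)"

text \<open>States \<open>(x\<^sub>g, x\<^sub>e, x\<^sub>h)\<close>.\<close>

type_synonym state = "(real^6) \<times> (real^4) \<times> (real^3)"

definition state_space :: "state set" where
  "state_space = {(xg, xe, xh). 0 < xh $ 2}"

definition Pm :: "params \<Rightarrow> 2 \<Rightarrow> real \<Rightarrow> real" where
  "Pm p i w = Ke p i * (w - Wo p i) / (1 - Wo p i)"

definition Qa :: "params \<Rightarrow> 2 \<Rightarrow> real \<Rightarrow> real" where
  "Qa p i w = Kh p i * (w + beta p i) / (1 + beta p i)"

definition Q12 :: "params \<Rightarrow> real \<Rightarrow> real" where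
  "Q12 p w = pi / 4 * h_c p * rho_s p * w"

definition Q21 :: "params \<Rightarrow> real \<Rightarrow> real" where
  "Q21 p w = - Q12 p w"

primrec bus_angle :: "real \<Rightarrow> real \<Rightarrow> bus \<Rightarrow> real" where
  "bus_angle \<delta>1 \<delta>2 (Site i) = (if i = 1 then \<delta>1 else \<delta>2)"
| "bus_angle \<delta>1 \<delta>2 Infinite_Bus = 0"

definition Pe :: "params \<Rightarrow> 2 \<Rightarrow> real \<Rightarrow> real \<Rightarrow> real" where
  "Pe p i \<delta>1 \<delta>2 =
     (\<Sum>j\<in>{Site 1, Site 2, Infinite_Bus}. volt p (Site i) * volt p j *
        (Gc p (Site i) j * cos (bus_angle \<delta>1 \<delta>2 (Site i) - bus_angle \<delta>1 \<delta>2 j) +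
         Bs p (Site i) j * sin (bus_angle \<delta>1 \<delta>2 (Site i) - bus_angle \<delta>1 \<delta>2 j)))"

definition Pe_inf :: "params \<Rightarrow> real \<Rightarrow> real \<Rightarrow> real" where
  "Pe_inf p \<delta>1 \<delta>2 =
     (\<Sum>i\<in>UNIV. volt p Infinite_Bus * volt p (Site i) *
        (Bs p Infinite_Bus (Site i) * sin (bus_angle \<delta>1 \<delta>2 (Site i)) -
         Gc p Infinite_Bus (Site i) * cos (bus_angle \<delta>1 \<delta>2 (Site i))))"

definition f_g :: "params \<Rightarrow> state \<Rightarrow> real^6" where
  "f_g p = (\<lambda>(xg, xe, xh). vector
     [(- xg$1 + Wo p 1) / Tv p 1, (- xg$2 + xg$1) / Tf p 1, (- xg$3 + xg$2) / TCD p 1,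
      (- xg$4 + Wo p 2) / Tv p 2, (- xg$5 + xg$4) / Tf p 2, (- xg$6 + xg$5) / TCD p 2])"

definition f_e :: "params \<Rightarrow> state \<Rightarrow> real^4" where
  "f_e p = (\<lambda>(xg, xe, xh). vector
     [xe$2 / Te p 1,
      (Pm p 1 (xg$3) - Damp p 1 * xe$2 - Pe p 1 (xe$1) (xe$3)) / Te p 1,
      xe$4 / Te p 2,
      (Pm p 2 (xg$6) - Damp p 2 * xe$4 - Pe p 2 (xe$1) (xe$3)) / Te p 2])"

definition f_h :: "params \<Rightarrow> state \<Rightarrow> real^3" where
  "f_h p = (\<lambda>(xg, xe, xh). vector
     [(Qa p 1 (xg$2) - QL p 1 - Q12 p (xh$2)) / Th1 p - (Qa p 2 (xg$5) - QL p 2 - Q21 p (xh$2)) / Th2 p,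
      1 / Th3 p * (xh$1 / rho_s p - pipe_lambda p * pipe_L p / (2 * pipe_d p) * xh$2 * \<bar>xh$2\<bar>),
      (Qa p 1 (xg$2) - QL p 1 + Qa p 2 (xg$5) - QL p 2) / (Th1 p + Th2 p)])"

definition drift :: "params \<Rightarrow> state \<Rightarrow> state" where
  "drift p x = (f_g p x, f_e p x, f_h p x)"

definition input_field :: "params \<Rightarrow> 2 \<Rightarrow> state \<Rightarrow> state" where
  "input_field p i x =
     (if i = 1 then (vector [(1 - Wo p 1) / Tv p 1, 0, 0, 0, 0, 0], 0, 0)
      else (vector [0, 0, 0, (1 - Wo p 2) / Tv p 2, 0, 0], 0, 0))"

definition out_e :: "params \<Rightarrow> state \<Rightarrow> real" where
  "out_e p = (\<lambda>(xg, xe, xh). Pe_inf p (xe$1) (xe$3))"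

definition out_h :: "params \<Rightarrow> state \<Rightarrow> real" where
  "out_h p = (\<lambda>(xg, xe, xh). Q12 p (xh$2))"

definition model_output :: "params \<Rightarrow> 2 \<Rightarrow> state \<Rightarrow> real" where
  "model_output p i = (if i = 1 then out_e p else out_h p)"

text \<open>Normal-form coordinates \<open>(\<xi>\<^sub>e, \<xi>\<^sub>h, \<eta>)\<close>.\<close>

type_synonym nf_state = "(real^5) \<times> (real^4) \<times> (real^4)"

definition normal_form_map :: "params \<Rightarrow> state \<Rightarrow> nf_state" where
  "normal_form_map p = (\<lambda>(xg, xe, xh).
     (vector (map (\<lambda>k. lie_deriv_pow (drift p) k (out_e p) (xg, xe, xh)) [0, 1, 2, 3, 4]),
      vector (map (\<lambda>k. lie_deriv_pow (drift p) k (out_h p) (xg, xe, xh)) [0, 1, 2, 3]),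
      vector [xg$3, xe$1, xe$2, xh$3]))"

definition internal_field :: "params \<Rightarrow> state \<Rightarrow> real^4" where
  "internal_field p x = vector [f_g p x $ 3, f_e p x $ 1, f_e p x $ 2, f_h p x $ 3]"

definition nf_internal_field :: "params \<Rightarrow> state set \<Rightarrow> nf_state \<Rightarrow> real^4" where
  "nf_internal_field p D = internal_field p \<circ> the_inv_into D (normal_form_map p)"

definition zero_error_point :: "real \<Rightarrow> real \<Rightarrow> real^4 \<Rightarrow> nf_state" where
  "zero_error_point Y1 Y2 \<eta> = (vector [Y1, 0, 0, 0, 0], vector [Y2, 0, 0, 0], \<eta>)"

definition zero_domain :: "params \<Rightarrow> state set \<Rightarrow> real \<Rightarrow> real \<Rightarrow> (real^4) set" where
  "zero_domain p D Y1 Y2 = {\<eta>. zero_error_point Y1 Y2 \<eta> \<in> normal_form_map p ` D}"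

definition zero_field :: "params \<Rightarrow> state set \<Rightarrow> real \<Rightarrow> real \<Rightarrow> real^4 \<Rightarrow> real^4" where
  "zero_field p D Y1 Y2 \<eta> = nf_internal_field p D (zero_error_point Y1 Y2 \<eta>)"

definition minimum_phase :: "params \<Rightarrow> state set \<Rightarrow> real \<Rightarrow> real \<Rightarrow> bool" where
  "minimum_phase p D Y1 Y2 \<longleftrightarrow>
     (\<exists>\<eta>. asymptotically_stable (zero_field p D Y1 Y2) (zero_domain p D Y1 Y2) \<eta>)"

definition non_minimum_phase :: "params \<Rightarrow> state set \<Rightarrow> real \<Rightarrow> real \<Rightarrow> bool" where
  "non_minimum_phase p D Y1 Y2 \<longleftrightarrow> \<not> minimum_phase p D Y1 Y2"

definition xh3_translation_invariant :: "state set \<Rightarrow> bool" where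
  "xh3_translation_invariant D \<longleftrightarrow>
     (\<forall>xg xe xh a. (xg, xe, xh) \<in> D \<longrightarrow> (xg, xe, vector [xh$1, xh$2, xh$3 + a]) \<in> D)"

lemma vector_4 [simp]:
  "(vector [a, b, c, d] :: 'a::zero^4) $ 1 = a"
  "(vector [a, b, c, d] :: 'a::zero^4) $ 2 = b"
  "(vector [a, b, c, d] :: 'a::zero^4) $ 3 = c"
  "(vector [a, b, c, d] :: 'a::zero^4) $ 4 = d"
  unfolding vector_def by simp_all

lemma vector_5 [simp]:
  "(vector [a, b, c, d, e] :: 'a::zero^5) $ 1 = a"
  "(vector [a, b, c, d, e] :: 'a::zero^5) $ 2 = b"
  "(vector [a, b, c, d, e] :: 'a::zero^5) $ 3 = c"
  "(vector [a, b, c, d, e] :: 'a::zero^5) $ 4 = d"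
  "(vector [a, b, c, d, e] :: 'a::zero^5) $ 5 = e"
  unfolding vector_def by simp_all

lemma vector_6 [simp]:
  "(vector [a, b, c, d, e, f] :: 'a::zero^6) $ 1 = a"
  "(vector [a, b, c, d, e, f] :: 'a::zero^6) $ 2 = b"
  "(vector [a, b, c, d, e, f] :: 'a::zero^6) $ 3 = c"
  "(vector [a, b, c, d, e, f] :: 'a::zero^6) $ 4 = d"
  "(vector [a, b, c, d, e, f] :: 'a::zero^6) $ 5 = e"
  "(vector [a, b, c, d, e, f] :: 'a::zero^6) $ 6 = f"
  unfolding vector_def by simp_all

end

theory Submission
  imports Defs
begin

text \<open>
  The state \<open>x\<^sub>h\<^sub>3\<close> enters neither the drift nor the outputs. Hence translations along \<open>x\<^sub>h\<^sub>3\<close> leave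
  all iterated Lie derivatives of the outputs unchanged, and in normal-form coordinates they act as
  translations along \<open>\<eta>\<^sub>4\<close> that preserve the zero dynamics. Equilibria therefore come in lines, and
  the constant solutions on such a line, arbitrarily close to a given equilibrium, do not converge
  to it.
\<close>

text \<open>The chain rule with a translation, whose derivative is the identity. The equivalence
  form lets the choice operator inside \<open>frechet_derivative\<close> be rewritten, so equality
  holds even where \<open>h\<close> is not differentiable.\<close>

lemma has_derivative_at_add:
  "(h has_derivative h') (at (x + c)) \<longleftrightarrow> ((\<lambda>y. h (y + c)) has_derivative h') (at x)"
proof
  assume "(h has_derivative h') (at (x + c))"
  moreover have "((\<lambda>y. y + c) has_derivative (\<lambda>y. y)) (at x)"
    by (auto intro!: derivative_eq_intros)
  ultimately show "((\<lambda>y. h (y + c)) has_derivative h') (at x)"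
    using has_derivative_compose by fastforce
next
  assume "((\<lambda>y. h (y + c)) has_derivative h') (at x)"
  then have "((\<lambda>y. h (y + c)) has_derivative h') (at ((x + c) - c))"
    by simp
  moreover have "((\<lambda>y. y - c) has_derivative (\<lambda>y. y)) (at (x + c))"
    by (auto intro!: derivative_eq_intros)
  ultimately have "((\<lambda>y. h ((y - c) + c)) has_derivative h') (at (x + c))"
    using has_derivative_compose by fastforce
  then show "(h has_derivative h') (at (x + c))"
    by simp
qed

text \<open>Invariance of \<open>h\<close> makes its candidate derivatives at \<open>x + c\<close>
  and at \<open>x\<close> the same, so \<open>frechet_derivative\<close> chooses the same map,
  applied to the same vector of \<open>v\<close>.\<close>

lemma lie_deriv_translation_invariant:
  assumes "\<And>x. v (x + c) = v x" and "\<And>x. h (x + c) = h x"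
  shows "lie_deriv v h (x + c) = lie_deriv v h x"
  using assms by (simp add: lie_deriv_def frechet_derivative_def has_derivative_at_add)

lemma lie_deriv_pow_translation_invariant:
  assumes "\<And>x. v (x + c) = v x" and "\<And>x. h (x + c) = h x"
  shows "lie_deriv_pow v k h (x + c) = lie_deriv_pow v k h x"
  using assms
  by (induction k arbitrary: x) (simp_all add: lie_deriv_pow_def lie_deriv_translation_invariant)

lemma not_isolated_in_line:
  fixes e w :: "'a::real_normed_vector"
  assumes "w \<noteq> 0" and "\<And>a. e + a *\<^sub>R w \<in> S"
  shows "\<not> e isolated_in S"
proof
  assume "e isolated_in S"
  then obtain T where "open T" and T: "T \<inter> S = {e}"
    by (auto simp: isolated_in_def)
  then obtain \<epsilon> where "\<epsilon> > 0" and ball: "\<And>y. dist y e < \<epsilon> \<Longrightarrow> y \<in> T"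
    by (metis Int_iff insertI1 open_dist)
  \<comment> \<open>The factor is chosen so that \<open>y\<close> lies at distance exactly
    \<open>\<epsilon> / 2\<close> from \<open>e\<close>: inside the ball, yet distinct from
    \<open>e\<close>.\<close>
  define y where "y = e + (\<epsilon> / (2 * norm w)) *\<^sub>R w"
  have "dist y e < \<epsilon>" and "y \<noteq> e"
    using \<open>\<epsilon> > 0\<close> \<open>w \<noteq> 0\<close> by (simp_all add: y_def dist_norm)
  then show False
    using ball T assms(2) unfolding y_def by blast
qed

text \<open>Each equilibrium on the line gives a constant solution that exists for all time; started
  close to \<open>e\<close> but not at it, it cannot tend to \<open>e\<close>.\<close>

lemma not_locally_attractive_line:
  fixes e w :: "'a::real_normed_vector"
  assumes "w \<noteq> 0" and line: "\<And>a. e + a *\<^sub>R w \<in> equilibria F Z"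
  shows "\<not> locally_attractive F Z e"
proof
  assume "locally_attractive F Z e"
  then obtain \<delta> where "\<delta> > 0" and \<delta>:
    "\<And>\<eta>. solution_on F Z {0..} \<eta> \<Longrightarrow> dist (\<eta> 0) e < \<delta> \<Longrightarrow> (\<eta> \<longlongrightarrow> e) at_top"
    by (auto simp: locally_attractive_def)
  define y where "y = e + (\<delta> / (2 * norm w)) *\<^sub>R w"
  have "dist y e < \<delta>" and "y \<noteq> e"
    using \<open>\<delta> > 0\<close> \<open>w \<noteq> 0\<close> by (simp_all add: y_def dist_norm)
  moreover have "solution_on F Z {0..} (\<lambda>_. y)"
    using line[of "\<delta> / (2 * norm w)"] by (simp add: solution_on_def equilibria_def y_def)
  ultimately show False
    using \<delta>[of "\<lambda>_. y"] by (simp add: tendsto_const_iff)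
qed

text \<open>Written as an added vector, so that the translation lemmas apply with this as
  \<open>c\<close>.\<close>

definition xh3_shift :: "real \<Rightarrow> state" where
  "xh3_shift a = (0, 0, vector [0, 0, a])"

lemma drift_xh3_shift: "drift p (x + xh3_shift a) = drift p x"
  by (cases x) (simp add: drift_def f_g_def f_e_def f_h_def xh3_shift_def)

lemma out_e_xh3_shift: "out_e p (x + xh3_shift a) = out_e p x"
  by (cases x) (simp add: out_e_def xh3_shift_def)

lemma out_h_xh3_shift: "out_h p (x + xh3_shift a) = out_h p x"
  by (cases x) (simp add: out_h_def xh3_shift_def)

lemma internal_field_xh3_shift: "internal_field p (x + xh3_shift a) = internal_field p x"
  using drift_xh3_shift[of p x a] by (simp add: internal_field_def drift_def)

lemma vector4_shift:
  "vector [\<eta>$1, \<eta>$2, \<eta>$3, \<eta>$4 + a] = \<eta> + a *\<^sub>R (axis 4 1 :: real^4)"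
  by (simp add: vec_eq_iff forall_4 axis_def)

text \<open>The \<xi> blocks are iterated Lie derivatives of invariant outputs along an invariant
  field; only the last coordinate, which is \<open>xh$3\<close> itself, picks up
  \<open>a\<close>.\<close>

lemma normal_form_map_xh3_shift:
  "normal_form_map p (x + xh3_shift a) = normal_form_map p x + (0, 0, a *\<^sub>R axis 4 1)"
proof (cases x)
  case (fields xg xe xh)
  have e: "lie_deriv_pow (drift p) k (out_e p) (xg, xe, xh + vector [0, 0, a])
      = lie_deriv_pow (drift p) k (out_e p) (xg, xe, xh)" for k
    using lie_deriv_pow_translation_invariant[of "drift p" "xh3_shift a" "out_e p" k "(xg, xe, xh)"]
    \<comment> \<open>The invariance premises are discharged while \<open>xh3_shift a\<close> is
      still folded; it is unfolded only afterwards, to match the goal.\<close>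
    by (simp add: drift_xh3_shift out_e_xh3_shift) (simp add: xh3_shift_def)
  have h: "lie_deriv_pow (drift p) k (out_h p) (xg, xe, xh + vector [0, 0, a])
      = lie_deriv_pow (drift p) k (out_h p) (xg, xe, xh)" for k
    using lie_deriv_pow_translation_invariant[of "drift p" "xh3_shift a" "out_h p" k "(xg, xe, xh)"]
    by (simp add: drift_xh3_shift out_h_xh3_shift) (simp add: xh3_shift_def)
  show ?thesis
    unfolding fields
    by (simp add: normal_form_map_def xh3_shift_def e h vec_eq_iff forall_4 axis_def)
qed

lemma xh3_translation_invariant_shift:
  assumes "xh3_translation_invariant D" and "x \<in> D"
  shows "x + xh3_shift a \<in> D"
proof (cases x)
  case (fields xg xe xh)
  have "(xg, xe, xh) + xh3_shift a = (xg, xe, vector [xh$1, xh$2, xh$3 + a])"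
    by (simp add: xh3_shift_def vec_eq_iff forall_3)
  then show ?thesis
    using assms by (simp add: fields xh3_translation_invariant_def)
qed

text \<open>By injectivity, the preimage of the shifted point under \<open>normal_form_map p\<close>
  is the shifted preimage, and \<open>internal_field\<close> takes the same value there.\<close>

lemma zero_dynamics_translation_invariant:
  assumes inv: "xh3_translation_invariant D" and inj: "inj_on (normal_form_map p) D"
    and "\<eta> \<in> zero_domain p D Y1 Y2"
  shows "\<eta> + a *\<^sub>R axis 4 1 \<in> zero_domain p D Y1 Y2"
    and "zero_field p D Y1 Y2 (\<eta> + a *\<^sub>R axis 4 1) = zero_field p D Y1 Y2 \<eta>"
proof -
  obtain x where x: "x \<in> D" and \<Phi>x: "zero_error_point Y1 Y2 \<eta> = normal_form_map p x"
    using assms(3) by (auto simp: zero_domain_def)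
  have x': "x + xh3_shift a \<in> D"
    using inv x by (rule xh3_translation_invariant_shift)
  have \<Phi>x': "zero_error_point Y1 Y2 (\<eta> + a *\<^sub>R axis 4 1) = normal_form_map p (x + xh3_shift a)"
    using \<Phi>x by (auto simp: zero_error_point_def normal_form_map_xh3_shift[of p x a] simp flip: \<Phi>x)
  show "\<eta> + a *\<^sub>R axis 4 1 \<in> zero_domain p D Y1 Y2"
    using x' \<Phi>x' by (auto simp: zero_domain_def)
  show "zero_field p D Y1 Y2 (\<eta> + a *\<^sub>R axis 4 1) = zero_field p D Y1 Y2 \<eta>"
    using x x' inj
    by (simp add: zero_field_def nf_internal_field_def \<Phi>x \<Phi>x' the_inv_into_f_f
        internal_field_xh3_shift)
qed

theorem mainTheorem2:
  fixes p :: params and D :: "state set" and Y1 Y2 :: real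
  assumes "valid_params p"
    and "open D" and "D \<subseteq> state_space"
    and "xh3_translation_invariant D"
    and "vector_relative_degree_on D (drift p) (input_field p) (model_output p)
           (\<lambda>i. if i = 1 then 5 else 4)"
    and "diffeomorphism_on_image D (normal_form_map p)"
  defines "F \<equiv> zero_field p D Y1 Y2" and "Z \<equiv> zero_domain p D Y1 Y2"
  shows "(\<forall>\<eta>\<in>equilibria F Z.
            {vector [\<eta>$1, \<eta>$2, \<eta>$3, \<eta>$4 + a] | a :: real. True} \<subseteq> equilibria F Z)
       \<and> (\<forall>\<eta>\<in>equilibria F Z. \<not> \<eta> isolated_in equilibria F Z)
       \<and> (\<forall>\<eta>\<in>equilibria F Z. \<not> asymptotically_stable F Z \<eta>)
       \<and> non_minimum_phase p D Y1 Y2"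
proof -
  have inj: "inj_on (normal_form_map p) D"
    using assms(6) by (simp add: diffeomorphism_on_image_def)
  have line: "\<eta> + a *\<^sub>R axis 4 1 \<in> equilibria F Z" if "\<eta> \<in> equilibria F Z" for \<eta> a
    using that zero_dynamics_translation_invariant[OF assms(4) inj]
    by (simp add: equilibria_def F_def Z_def)
  have "(axis 4 1 :: real^4) \<noteq> 0"
    by (simp add: axis_eq_0_iff)
  \<comment> \<open>Asymptotic stability would make \<open>\<eta>\<close> an equilibrium, hence put
    a whole line of equilibria through it, which contradicts attractivity.\<close>
  then have unstable: "\<not> asymptotically_stable F Z \<eta>" for \<eta>
    using not_locally_attractive_line line unfolding asymptotically_stable_def by blast
  moreover have "\<not> \<eta> isolated_in equilibria F Z" if "\<eta> \<in> equilibria F Z" for \<eta>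
    using not_isolated_in_line \<open>axis 4 1 \<noteq> 0\<close> line[OF that] by blast
  \<comment> \<open>\<open>unstable\<close> ranges over all \<open>\<eta>\<close>, so this also
    covers the case of an empty equilibrium set.\<close>
  moreover have "non_minimum_phase p D Y1 Y2"
    using unstable by (simp add: non_minimum_phase_def minimum_phase_def F_def Z_def)
  ultimately show ?thesis
    using line by (auto simp: vector4_shift)
qed

end
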